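(* Let $Z$ be a locally compact Hausdorff space. If $X$ is an Ascoli space, then so is $Z\times X$.
   Context: A Tychonoff space $X$ is Ascoli if every compact subset $K$ of $C_k(X)$ (the space of continuous real-valued functions on $X$ with the compact-open topology) is evenly continuous, i.e. the evaluation map $X\times K\to\mathbb{R}$, $(x,f)\mapsto f(x)$, is continuous. *)

theory Defs
  imports "HOL-Analysis.Analysis"
begin

(* Continuous functions on X are represented by the members of extensional (topspace X),
   so that each continuous function on X corresponds to exactly one HOL function. *)
definition continuous_functions :: "'a topology \<Rightarrow> ('a \<Rightarrow> real) set" where
  "continuous_functions X = {f \<in> extensional (topspace X). continuous_map X euclideanreal f}"

(* The compact-open topology: its subbase consists of the sets [K; U] = {f. f(K) \<subseteq> U}. *)
definition Ck :: "'a topology \<Rightarrow> ('a \<Rightarrow> real) topology" where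
  "Ck X = topology_generated_by
     {{f \<in> continuous_functions X. f ` K \<subseteq> U} | K U. compactin X K \<and> open U}"

lemma topspace_Ck: "topspace (Ck X) = continuous_functions X"
proof -
  have "compactin X {}" "open (UNIV :: real set)" by simp_all
  then have "continuous_functions X \<in>
      {{f \<in> continuous_functions X. f ` K \<subseteq> U} | K U. compactin X K \<and> open U}"
    by blast
  then show ?thesis
    unfolding Ck_def topology_generated_by_topspace by blast
qed

definition tychonoff_space :: "'a topology \<Rightarrow> bool" where
  "tychonoff_space X \<longleftrightarrow> completely_regular_space X \<and> Hausdorff_space X"

definition evenly_continuous :: "'a topology \<Rightarrow> ('a \<Rightarrow> real) set \<Rightarrow> bool" where
  "evenly_continuous X K \<longleftrightarrow>
     continuous_map (prod_topology X (subtopology (Ck X) K)) euclideanreal (\<lambda>(x, f). f x)"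

definition ascoli_space :: "'a topology \<Rightarrow> bool" where
  "ascoli_space X \<longleftrightarrow>
     tychonoff_space X \<and> (\<forall>K. compactin (Ck X) K \<longrightarrow> evenly_continuous X K)"

end

(* By the exponential law, (z, f) \<mapsto> f(z, -) is a continuous map from Z \<times> C_k(Z \<times> X) to C_k(X),
   because Z is locally compact. For compact C \<subseteq> Z and compact K \<subseteq> C_k(Z \<times> X) the image of C \<times> K
   is therefore compact in C_k(X), hence evenly continuous since X is Ascoli. As
   f(z, x) = (f(z, -))(x), evaluation is continuous on C \<times> X \<times> K, and the interiors of the compact
   sets C cover Z. *)
theory Submission
  imports Defs
begin

text \<open>The restriction to \<open>topspace X\<close> makes f(z, -) extensional, as membership in
  \<open>continuous_functions X\<close> demands. Taking a pair as argument allows joint continuity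
  in z and f to be stated directly.\<close>

definition slice :: "'b topology \<Rightarrow> 'a \<times> ('a \<times> 'b \<Rightarrow> real) \<Rightarrow> 'b \<Rightarrow> real" where
  "slice X = (\<lambda>(z, f). \<lambda>x\<in>topspace X. f (z, x))"

lemma slice_in_continuous_functions:
  assumes "z \<in> topspace Z" "f \<in> continuous_functions (prod_topology Z X)"
  shows "slice X (z, f) \<in> continuous_functions X"
proof -
  have "continuous_map (prod_topology Z X) euclideanreal f"
    using assms(2) by (simp add: continuous_functions_def)
  moreover have "continuous_map X (prod_topology Z X) (\<lambda>x. (z, x))"
    using assms(1) by (simp add: continuous_map_pairedI)
  ultimately have "continuous_map X euclideanreal (\<lambda>x. f (z, x))"
    using continuous_map_compose[unfolded o_def] by blast
  then show ?thesis
    by (auto simp: continuous_functions_def slice_def elim: continuous_map_eq)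
qed

lemma openin_Ck_subbasic:
  assumes "compactin X K" "open U"
  shows "openin (Ck X) {f \<in> continuous_functions X. f ` K \<subseteq> U}"
  unfolding Ck_def using assms by (intro topology_generated_by_Basis) blast

text \<open>Only preimages of subbasic sets [A; W] matter. If f(z, -) maps A into W, then f maps C
  \<times> A into W for some compact neighbourhood C of z, and the condition on C \<times> A is
  itself subbasic.\<close>

lemma continuous_map_slice:
  assumes "locally_compact_space Z" "Hausdorff_space Z"
  shows "continuous_map (prod_topology Z (Ck (prod_topology Z X))) (Ck X) (slice X)"
proof -
  let ?P = "prod_topology Z (Ck (prod_topology Z X))"
  let ?S = "{{f \<in> continuous_functions X. f ` K \<subseteq> U} | K U. compactin X K \<and> open U}"
  have top: "topspace ?P = topspace Z \<times> continuous_functions (prod_topology Z X)"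
    by (simp add: topspace_Ck)
  have maps: "slice X p \<in> continuous_functions X" if "p \<in> topspace ?P" for p
    using that slice_in_continuous_functions unfolding top by fast
  have "openin ?P (slice X -` {f \<in> continuous_functions X. f ` A \<subseteq> W} \<inter> topspace ?P)"
    (is "openin ?P ?G")
    if A: "compactin X A" and W: "open W" for A W
  proof (subst openin_subopen, intro ballI)
    fix p assume p: "p \<in> ?G"
    obtain z f where zf: "p = (z, f)" by force
    have z: "z \<in> topspace Z" and f: "f \<in> continuous_functions (prod_topology Z X)"
      using p zf top by auto
    have AX: "A \<subseteq> topspace X"
      using A by (simp add: compactin_subset_topspace)
    let ?V = "{q \<in> topspace (prod_topology Z X). f q \<in> W}"
    have "openin (prod_topology Z X) ?V"
      using f W openin_continuous_map_preimage unfolding continuous_functions_def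
      by fastforce
    \<comment> \<open>Since A lies in \<open>topspace X\<close>, \<open>p \<in> ?G\<close> says that
      {z} \<times> A lies in the open set \<open>?V\<close>; compactness of A thickens this slice to
      a box.\<close>
    from tube_lemma_right[OF this A z] obtain U V
      where UV: "openin Z U" "z \<in> U" "A \<subseteq> V" "U \<times> V \<subseteq> ?V"
      using p z AX by (auto simp: zf slice_def image_subset_iff subset_iff)
    \<comment> \<open>The Hausdorff property turns local compactness into arbitrarily small compact
      neighbourhoods, so that C fits inside the tube's base U.\<close>
    have "neighbourhood_base_of (compactin Z) Z"
      using assms locally_compact_space_neighbourhood_base by blast
    then obtain N C where NC: "openin Z N" "compactin Z C" "z \<in> N" "N \<subseteq> C" "C \<subseteq> U"
      using UV unfolding neighbourhood_base_of by meson
    let ?B = "{g \<in> continuous_functions (prod_topology Z X). g ` (C \<times> A) \<subseteq> W}"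
    have "openin (Ck (prod_topology Z X)) ?B"
      using NC A W by (intro openin_Ck_subbasic) (auto simp: compactin_Times)
    then have "openin ?P (N \<times> ?B)"
      using NC by (simp add: openin_prod_Times_iff)
    moreover have "p \<in> N \<times> ?B"
    proof -
      have "C \<times> A \<subseteq> ?V"
        using NC(5) UV(3,4) by (meson Sigma_mono order_trans)
      then have "f ` (C \<times> A) \<subseteq> W"
        by blast
      then show ?thesis
        using NC(3) f unfolding zf by blast
    qed
    moreover have "N \<times> ?B \<subseteq> ?G"
    proof
      fix q assume q: "q \<in> N \<times> ?B"
      then have "q \<in> topspace ?P"
        using \<open>openin ?P (N \<times> ?B)\<close> openin_subset by blast
      moreover have "slice X q ` A \<subseteq> W"
        using q AX NC by (auto simp: slice_def image_subset_iff subset_iff)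
      ultimately show "q \<in> ?G"
        using maps by simp
    qed
    ultimately show "\<exists>T. openin ?P T \<and> p \<in> T \<and> T \<subseteq> ?G"
      by blast
  qed
  \<comment> \<open>The carrier of a generated topology is the union of its subbase, so the values
    must be shown to lie there as well.\<close>
  moreover have "slice X ` topspace ?P \<subseteq> \<Union> ?S"
    using maps topspace_Ck[of X] unfolding Ck_def topology_generated_by_topspace
    by blast
  ultimately show ?thesis
    unfolding Ck_def[of X] by (intro continuous_on_generated_topo) blast+
qed

lemma evenly_continuous_prod_topology:
  assumes Z: "locally_compact_space Z" "Hausdorff_space Z"
    and X: "\<And>L. compactin (Ck X) L \<Longrightarrow> evenly_continuous X L"
    and K: "compactin (Ck (prod_topology Z X)) K"
  shows "evenly_continuous (prod_topology Z X) K"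
proof -
  let ?Q = "subtopology (Ck (prod_topology Z X)) K"
  let ?P = "prod_topology (prod_topology Z X) ?Q"
  let ?ev = "\<lambda>((z, x), f). f (z, x) :: real"
  let ?I = "{U. openin Z U \<and> (\<exists>C. compactin Z C \<and> U \<subseteq> C)}"
  let ?T = "\<lambda>U. (U \<times> topspace X) \<times> topspace ?Q"
  have "continuous_map ?P euclideanreal ?ev"
  \<comment> \<open>The pieces are indexed by open sets U with a compact superset C, because open
    covers paste without any finiteness condition. All pieces carry the same function, so agreement
    on overlaps is trivial.\<close>
  proof (rule pasting_lemma[where I = ?I and T = ?T and f = "\<lambda>_. ?ev"])
    show "openin ?P (?T U)" if "U \<in> ?I" for U
      using that by (simp only: openin_prod_Times_iff openin_topspace mem_Collect_eq simp_thms)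
  next
    fix U assume "U \<in> ?I"
    then obtain C where C: "compactin Z C" "U \<subseteq> C" by blast
    let ?S = "subtopology ?P (?T U)"
    \<comment> \<open>Here z ranges over C instead of U, since U need not be compact.\<close>
    define L where "L = slice X ` (C \<times> K)"
    have "compactin (prod_topology Z (Ck (prod_topology Z X))) (C \<times> K)"
      using C K by (simp add: compactin_Times)
    then have "compactin (Ck X) L"
      unfolding L_def using continuous_map_slice[OF Z] image_compactin by blast
    then have ev: "continuous_map (prod_topology X (subtopology (Ck X) L)) euclideanreal
        (\<lambda>(x, f). f x)"
      using X by (simp add: evenly_continuous_def)
    have fst: "continuous_map ?S (prod_topology Z X) fst"
      by (intro continuous_map_from_subtopology continuous_map_fst)
    have z: "continuous_map ?S Z (\<lambda>p. fst (fst p))"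
      and x: "continuous_map ?S X (\<lambda>p. snd (fst p))"
      using continuous_map_compose[OF fst continuous_map_fst]
        continuous_map_compose[OF fst continuous_map_snd] by (simp_all add: o_def)
    have f: "continuous_map ?S (Ck (prod_topology Z X)) snd"
      using continuous_map_snd continuous_map_from_subtopology continuous_map_in_subtopology
      by blast
    have "continuous_map ?S (Ck X) (\<lambda>p. slice X (fst (fst p), snd p))"
      using continuous_map_compose[OF continuous_map_pairedI[OF z f] continuous_map_slice[OF Z]]
      by (simp add: o_def)
    moreover have "slice X (fst (fst p), snd p) \<in> L" if "p \<in> topspace ?S" for p
      using that C(2) unfolding L_def by auto
    ultimately have "continuous_map ?S (subtopology (Ck X) L) (\<lambda>p. slice X (fst (fst p), snd p))"
      by (intro continuous_map_into_subtopology) auto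
    \<comment> \<open>On this piece, evaluation factors through ((z, x), f) \<mapsto> (x, f(z, -))
      into X \<times> L, where \<open>ev\<close> applies.\<close>
    then have "continuous_map ?S euclideanreal
        ((\<lambda>(x, f). f x) \<circ> (\<lambda>p. (snd (fst p), slice X (fst (fst p), snd p))))"
      by (intro continuous_map_compose[OF _ ev] continuous_map_pairedI x)
    then show "continuous_map ?S euclideanreal ?ev"
      \<comment> \<open>Points of \<open>?S\<close> have x in \<open>topspace X\<close>, where the
        restriction in \<open>slice\<close> changes nothing.\<close>
      by (rule continuous_map_eq) (auto simp: slice_def)
  next
    fix p assume p: "p \<in> topspace ?P"
    then have "fst (fst p) \<in> topspace Z"
      by auto
    then obtain U C where "openin Z U" "compactin Z C" "fst (fst p) \<in> U" "U \<subseteq> C"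
      using Z(1) unfolding locally_compact_space_def by meson
    then show "\<exists>U. U \<in> ?I \<and> p \<in> ?T U \<and> ?ev p = ?ev p"
      using p by (intro exI[of _ U]) auto
  qed simp
  then show ?thesis
    by (simp add: evenly_continuous_def case_prod_unfold)
qed

theorem theorem4p2:
  fixes Z :: "'a topology" and X :: "'b topology"
  assumes "locally_compact_space Z" and "Hausdorff_space Z"
    and "ascoli_space X"
  shows "ascoli_space (prod_topology Z X)"
proof -
  \<comment> \<open>Z is completely regular because it is locally compact Hausdorff; both Tychonoff
    conditions then pass to the product.\<close>
  have "tychonoff_space (prod_topology Z X)"
    using assms locally_compact_regular_imp_completely_regular_space
    by (auto simp: ascoli_space_def tychonoff_space_def completely_regular_space_prod_topology
        Hausdorff_space_prod_topology)
  then show ?thesis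
    using assms evenly_continuous_prod_topology unfolding ascoli_space_def by blast
qed

end
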